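(* (i) Let $\Omega\subseteq\mathbb{R}^2$ be an open set with $(0,0)\in\Omega$, and let $f:\Omega\to\mathbb{R}$ be a $C^1$ function such that $f(0,0)=0$ and, for all $(x,y)\in\mathbb{R}^2$, $$(x,y)\in\Omega\quad\Longrightarrow\quad (y,x)\in\Omega\ \text{ and }\ f(y,x)=f(x,y).$$ Let $\Gamma$ be the connected component of the zero set $f^{-1}(0)=\{(x,y)\in\Omega: f(x,y)=0\}$ that contains the origin $(0,0)$. Suppose that $\partial_2 f(x,y)\neq 0$ for all $(x,y)\in\Gamma$, and that $\Gamma$ projects onto the whole $x$-axis, i.e. for each $x\in\mathbb{R}$ there is some $y\in\mathbb{R}$ with $(x,y)\in\Gamma$. Then $\Gamma$ is the graph of a global involution $h:\mathbb{R}\to\mathbb{R}$. (ii) Conversely, all global involutions can be obtained this way: for every global involution $h:\mathbb{R}\to\mathbb{R}$ there exist an open set $\Omega\subseteq\mathbb{R}^2$ and a $C^1$ function $f:\Omega\to\mathbb{R}$ satisfying all the hypotheses in (i) such that the connected component $\Gamma$ of $f^{-1}(0)$ containing the origin is the graph of $h$.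
   Context: A $C^1$ diffeomorphism $h$ of an open interval $J\subseteq\mathbb{R}$ onto itself is called an involution if $h^{-1}=h$, $0\in J$, $h(0)=0$ and $h'(0)=-1$. A global involution is an involution defined on the whole real line, i.e. one with $J=\mathbb{R}$. Here $\partial_2 f$ denotes the partial derivative of $f$ with respect to its second variable. *)

theory Defs
  imports "HOL-Analysis.Analysis"
begin

(* Real functions of one variable use the library's C1_differentiable_on; this is the analogue
   on an open subset of the plane, with the Frechet derivative continuous in operator norm.
   Functions on a domain are total, and their values outside the domain are irrelevant:
   only meant for open domains. *)
definition C1_on_plane :: "(real \<times> real \<Rightarrow> real) \<Rightarrow> (real \<times> real) set \<Rightarrow> bool" where
  "C1_on_plane f \<Omega> \<longleftrightarrow>
     (\<exists>f' :: real \<times> real \<Rightarrow> (real \<times> real) \<Rightarrow>\<^sub>L real.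
        (\<forall>p\<in>\<Omega>. (f has_derivative blinfun_apply (f' p)) (at p)) \<and> continuous_on \<Omega> f')"

definition partial2 :: "(real \<times> real \<Rightarrow> real) \<Rightarrow> real \<times> real \<Rightarrow> real" where
  "partial2 f p = deriv (\<lambda>t. f (fst p, t)) (snd p)"

definition C1_self_diffeo :: "real set \<Rightarrow> (real \<Rightarrow> real) \<Rightarrow> bool" where
  "C1_self_diffeo J h \<longleftrightarrow>
     bij_betw h J J \<and> h C1_differentiable_on J \<and> inv_into J h C1_differentiable_on J"

definition involution_on :: "real set \<Rightarrow> (real \<Rightarrow> real) \<Rightarrow> bool" where
  "involution_on J h \<longleftrightarrow>
     open J \<and> is_interval J \<and> C1_self_diffeo J h \<and> (\<forall>x\<in>J. inv_into J h x = h x) \<and>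
     0 \<in> J \<and> h 0 = 0 \<and> (h has_real_derivative -1) (at 0)"

abbreviation global_involution :: "(real \<Rightarrow> real) \<Rightarrow> bool" where
  "global_involution h \<equiv> involution_on UNIV h"

definition zero_component :: "(real \<times> real) set \<Rightarrow> (real \<times> real \<Rightarrow> real) \<Rightarrow> (real \<times> real) set" where
  "zero_component \<Omega> f = connected_component_set {p \<in> \<Omega>. f p = 0} (0, 0)"

definition graph_of :: "(real \<Rightarrow> real) \<Rightarrow> (real \<times> real) set" where
  "graph_of h = {(x, y). y = h x}"

definition symmetric_implicit_data ::
  "(real \<times> real) set \<Rightarrow> (real \<times> real \<Rightarrow> real) \<Rightarrow> bool" where
  "symmetric_implicit_data \<Omega> f \<longleftrightarrow>
     open \<Omega> \<and> (0, 0) \<in> \<Omega> \<and> C1_on_plane f \<Omega> \<and> f (0, 0) = 0 \<and>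
     (\<forall>x y. (x, y) \<in> \<Omega> \<longrightarrow> (y, x) \<in> \<Omega> \<and> f (y, x) = f (x, y)) \<and>
     (\<forall>p \<in> zero_component \<Omega> f. partial2 f p \<noteq> 0) \<and>
     (\<forall>x. \<exists>y. (x, y) \<in> zero_component \<Omega> f)"

end

theory Submission
  imports Defs
begin

text \<open>
  Near each of its points, \<open>\<Gamma>\<close> is the graph of a function of \<open>x\<close> by the implicit function theorem.
  Hence \<open>\<Gamma>\<close> is locally path connected, so any two of its points are joined by an arc in \<open>\<Gamma>\<close>.
  If the two points had the same abscissa, the abscissa would have an interior extremum along the arc,
  where it could not be locally injective. So \<open>\<Gamma>\<close> is the graph of a function \<open>h\<close>, which is \<open>C\<^sup>1\<close> with
  \<open>h' = - \<partial>\<^sub>1 f / \<partial>\<^sub>2 f\<close>. Reflection in the diagonal preserves \<open>\<Gamma>\<close>, which gives \<open>h (h x) = x\<close>, and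
  symmetry of \<open>f\<close> gives \<open>\<partial>\<^sub>1 f = \<partial>\<^sub>2 f\<close> at the origin, which gives \<open>h' 0 = - 1\<close>.

  Conversely, a global involution has \<open>h' < 0\<close>, so \<open>y - h y\<close> is strictly increasing, and
  \<open>f (x, y) = (x - h x) + (y - h y)\<close> is symmetric and vanishes exactly on the graph of \<open>h\<close>.
\<close>

section \<open>Locally injective projections of path connected sets\<close>

text \<open>An arc, rather than just a path, is what makes the argument work: its injectivity
  transfers local injectivity of \<open>fst\<close> on \<open>S\<close> to the abscissa along the
  arc, which is then strictly monotone near each interior parameter.\<close>

lemma inj_on_fst_if_locally_inj:
  fixes S :: "(real \<times> 'a::banach) set"
  assumes "path_connected S"
    and loc: "\<And>p. p \<in> S \<Longrightarrow> \<exists>U. open U \<and> p \<in> U \<and> inj_on fst (S \<inter> U)"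
  shows "inj_on fst S"
proof (rule inj_onI, rule ccontr)
  fix x y assume xy: "x \<in> S" "y \<in> S" "fst x = fst y" "x \<noteq> y"
  then obtain g where g: "arc g" "path_image g \<subseteq> S" "pathstart g = x" "pathfinish g = y"
    using assms(1) unfolding path_connected_arcwise by blast
  define c where "c = (\<lambda>t. fst (g t))"
  have contg: "continuous_on {0..1} g" and injg: "inj_on g {0..1}"
    using g(1) by (auto simp: arc_def path_def)
  have contc: "continuous_on {0..1} c"
    unfolding c_def by (intro continuous_intros contg)
  have c01: "c 0 = c 1"
    using g(3,4) xy(3) by (simp add: c_def pathstart_def pathfinish_def)
  obtain m where m: "m \<in> {0..1}" "\<And>t. t \<in> {0..1} \<Longrightarrow> c m \<le> c t"
    using continuous_attains_inf[of "{0..1::real}" c] contc by auto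
  obtain M where M: "M \<in> {0..1}" "\<And>t. t \<in> {0..1} \<Longrightarrow> c t \<le> c M"
    using continuous_attains_sup[of "{0..1::real}" c] contc by auto
  \<comment> \<open>If both extrema sit at end points, the equal end values force \<open>c\<close>
    to be constant, and the midpoint is an extremum.\<close>
  have "\<exists>t\<in>{0<..<1}. (\<forall>s\<in>{0..1}. c t \<le> c s) \<or> (\<forall>s\<in>{0..1}. c s \<le> c t)"
  proof (cases "m \<in> {0<..<1} \<or> M \<in> {0<..<1}")
    case True
    then show ?thesis using m M by blast
  next
    case False
    then have "m \<in> {0, 1}" "M \<in> {0, 1}" using m(1) M(1) by auto
    then have "c m = c M" using c01 by auto
    then have "\<forall>s\<in>{0..1}. c s \<le> c (1/2)" using m(2)[of "1/2"] M(2) by fastforce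
    then show ?thesis by (intro bexI[of _ "1/2"]) auto
  qed
  then obtain t where t: "0 < t" "t < 1"
    and ext: "(\<forall>s\<in>{0..1}. c t \<le> c s) \<or> (\<forall>s\<in>{0..1}. c s \<le> c t)"
    by auto
  have inS: "g s \<in> S" if "s \<in> {0..1}" for s
    using g(2) that by (auto simp: path_image_def)
  obtain U where U: "open U" "g t \<in> U" "inj_on fst (S \<inter> U)"
    using loc[OF inS[of t]] t by auto
  have "isCont g t"
    using contg t continuous_on_interior[of "{0..1}" g t] by simp
  then have "\<forall>\<^sub>F s in at t. g s \<in> U"
    using U(1,2) unfolding isCont_def by (rule topological_tendstoD)
  then obtain d where d: "d > 0" "\<And>s. s \<noteq> t \<Longrightarrow> dist s t < d \<Longrightarrow> g s \<in> U"
    unfolding eventually_at by auto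
  \<comment> \<open>Halving \<open>d\<close> lets the closed interval around \<open>t\<close>
    satisfy the strict bound \<open>dist s t < d\<close>; the other terms keep it inside the unit
    interval.\<close>
  define e where "e = min (d / 2) (min t (1 - t))"
  have e: "e > 0" "e < d" "e \<le> t" "e \<le> 1 - t"
    using d(1) t by (auto simp: e_def)
  have sub: "{t - e..t + e} \<subseteq> {0..1}" using e by auto
  have U': "g s \<in> U" if "s \<in> {t - e..t + e}" for s
    using d(2)[of s] U(2) that e by (cases "s = t") (auto simp: dist_real_def abs_if)
  have "inj_on c {t - e..t + e}"
  proof (rule inj_onI)
    fix a b assume ab: "a \<in> {t - e..t + e}" "b \<in> {t - e..t + e}" "c a = c b"
    then have "g a = g b"
      using U(3) inS U' sub unfolding c_def inj_on_def by blast
    then show "a = b" using injg ab sub unfolding inj_on_def by blast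
  qed
  moreover have "continuous_on {t - e..t + e} c"
    using contc sub continuous_on_subset by blast
  ultimately have "c (t - e) < c t \<and> c t < c (t + e) \<or> c (t + e) < c t \<and> c t < c (t - e)"
    using continuous_inj_imp_mono[of "t - e" t "t + e" c] e by auto
  moreover have "t - e \<in> {0..1}" "t + e \<in> {0..1}" using e t by auto
  ultimately show False using ext by (meson not_le)
qed

section \<open>The implicit function theorem in the plane\<close>

lemma has_real_derivative_slice:
  fixes f :: "real \<times> real \<Rightarrow> real"
  assumes "(f has_derivative D) (at (x, t))"
  shows "((\<lambda>t. f (x, t)) has_real_derivative D (0, 1)) (at t)"
proof -
  interpret bounded_linear D using assms by (rule has_derivative_bounded_linear)
  have "((\<lambda>t. f (x, t)) has_derivative (\<lambda>u. D (0, u))) (at t)"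
    by (rule has_derivative_compose[where f = "\<lambda>t. (x, t)" and g = f, OF _ assms])
      (auto intro!: derivative_eq_intros)
  moreover have "(\<lambda>u. D (0, u)) = (*) (D (0, 1))"
  proof
    fix u show "D (0, u) = D (0, 1) * u" using scaleR[of u "(0, 1)"] by simp
  qed
  ultimately show ?thesis unfolding has_field_derivative_def by metis
qed

lemma partial2_eq:
  assumes "(f has_derivative D) (at p)"
  shows "partial2 f p = D (0, 1)"
  unfolding partial2_def
  using has_real_derivative_slice[of f D "fst p" "snd p"] assms by (simp add: DERIV_imp_deriv)

text \<open>On a small box the second partial derivative has no zero, so Rolle's theorem allows at
  most one zero of \<open>f\<close> on each vertical segment. A sign change between the two ends of
  the segment, stable for \<open>x\<close> near \<open>a\<close>, supplies a zero. The boxes are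
  closed so that compactness of \<open>cball b s\<close> gives continuity of
  \<open>g\<close>.\<close>

lemma implicit_graph:
  fixes f :: "real \<times> real \<Rightarrow> real" and f' :: "real \<times> real \<Rightarrow> (real \<times> real) \<Rightarrow>\<^sub>L real"
  assumes W: "open W" "(a, b) \<in> W"
    and f': "\<And>p. p \<in> W \<Longrightarrow> (f has_derivative f' p) (at p)"
    and contf': "continuous_on W f'"
    and zero: "f (a, b) = 0" and nz: "f' (a, b) (0, 1) \<noteq> 0"
  obtains r s g where "r > 0" "s > 0" "cball a r \<times> cball b s \<subseteq> W"
    "continuous_on (cball a r) g" "g \<in> cball a r \<rightarrow> cball b s"
    "\<And>x y. x \<in> cball a r \<Longrightarrow> y \<in> cball b s \<Longrightarrow> f (x, y) = 0 \<longleftrightarrow> y = g x"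
proof -
  have contf: "continuous_on W f"
    using f' has_derivative_continuous by (blast intro: continuous_at_imp_continuous_on)
  have "continuous_on W (\<lambda>p. f' p (0, 1))"
    by (intro continuous_intros contf')
  then have "open ({p \<in> W. f' p (0, 1) \<noteq> 0})"
    using continuous_open_preimage[of W "\<lambda>p. f' p (0, 1)" "- {0}"] W(1)
    by (simp add: vimage_def Int_def open_Compl)
  then obtain A B where AB: "open A" "open B" "a \<in> A" "b \<in> B"
    "A \<times> B \<subseteq> {p \<in> W. f' p (0, 1) \<noteq> 0}"
    using W(2) nz by (elim open_prod_elim[of _ "(a, b)"]) auto
  obtain r0 where r0: "r0 > 0" "cball a r0 \<subseteq> A"
    using AB open_contains_cball by blast
  obtain s where s: "s > 0" "cball b s \<subseteq> B"
    using AB open_contains_cball by blast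
  have box: "(x, y) \<in> W" "f' (x, y) (0, 1) \<noteq> 0" if "x \<in> cball a r0" "y \<in> cball b s" for x y
    using that AB(5) r0 s by blast+
  have slice: "((\<lambda>t. f (x, t)) has_real_derivative f' (x, y) (0, 1)) (at y)"
    if "x \<in> cball a r0" "y \<in> cball b s" for x y
    using has_real_derivative_slice f' box(1)[OF that] by blast
  have cslice: "continuous_on (cball b s) (\<lambda>t. f (x, t))" if "x \<in> cball a r0" for x
    using slice[OF that] DERIV_isCont by (blast intro: continuous_at_imp_continuous_on)
  have less: False if x: "x \<in> cball a r0" and y: "y \<in> cball b s" "z \<in> cball b s"
    "f (x, y) = f (x, z)" "y < z" for x y z
  proof -
    have sub: "{y..z} \<subseteq> cball b s" using y by (auto simp: cball_eq_atLeastAtMost)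
    have "\<exists>l>y. l < z \<and> (\<lambda>u. f' (x, l) (0, 1) * u) = (\<lambda>v. 0)"
    proof (rule Rolle_deriv[OF y(4) y(3) continuous_on_subset[OF cslice[OF x] sub]])
      fix l assume "y < l" "l < z"
      then have "l \<in> cball b s" using subsetD[OF sub, of l] by simp
      then show "((\<lambda>t. f (x, t)) has_derivative (\<lambda>u. f' (x, l) (0, 1) * u)) (at l)"
        using slice[OF x] by (simp add: has_field_derivative_def)
    qed
    then obtain l where l: "y < l" "l < z" "f' (x, l) (0, 1) * 1 = 0"
      by (metis (mono_tags))
    have "l \<in> cball b s" using l(1,2) subsetD[OF sub, of l] by simp
    then show False using box(2)[OF x, of l] l(3) by simp
  qed
  have uniq: "y = z" if "x \<in> cball a r0" "y \<in> cball b s" "z \<in> cball b s"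
    "f (x, y) = f (x, z)" for x y z
    using less[of x y z] less[of x z y] that by (metis linorder_neqE_linordered_idom)
  have ends: "b - s \<in> cball b s" "b + s \<in> cball b s" "b \<in> cball b s" "a \<in> cball a r0"
    using s r0 by (auto simp: dist_real_def)
  have "inj_on (\<lambda>t. f (a, t)) (cball b s)"
    by (rule inj_onI) (rule uniq[OF ends(4)])
  \<comment> \<open>The slice at \<open>a\<close> is continuous and injective, hence strictly
    monotone, and it vanishes at \<open>b\<close>. A product records the sign change without fixing
    its direction.\<close>
  then have opp: "f (a, b - s) * f (a, b + s) < 0"
    using continuous_inj_imp_mono[of "b - s" b "b + s" "\<lambda>t. f (a, t)"] cslice[OF ends(4)]
      s zero by (auto simp: cball_eq_atLeastAtMost mult_less_0_iff)
  have "continuous_on (cball a r0) (\<lambda>x. f (x, b - s) * f (x, b + s))"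
    using box(1) ends by (intro continuous_intros continuous_on_compose2[OF contf]) auto
  then have "isCont (\<lambda>x. f (x, b - s) * f (x, b + s)) a"
    by (rule continuous_on_interior) (use r0 in simp)
  then have "\<forall>\<^sub>F x in at a. f (x, b - s) * f (x, b + s) < 0"
    unfolding isCont_def using opp by (rule order_tendstoD)
  then obtain r1 where r1: "r1 > 0"
    "\<And>x. x \<noteq> a \<Longrightarrow> dist x a < r1 \<Longrightarrow> f (x, b - s) * f (x, b + s) < 0"
    unfolding eventually_at by auto
  \<comment> \<open>Halving \<open>r1\<close> makes the sign change hold on the closed ball as
    well.\<close>
  define r where "r = min r0 (r1 / 2)"
  have r: "r > 0" "r \<le> r0" "r < r1" using r0 r1 by (auto simp: r_def)
  have sub: "cball a r \<subseteq> cball a r0" using r by auto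
  have "\<exists>y\<in>cball b s. f (x, y) = 0" if x: "x \<in> cball a r" for x
  proof -
    have "f (x, b - s) * f (x, b + s) < 0"
      using r1(2)[of x] opp x r by (cases "x = a") (auto simp: dist_commute)
    moreover have "connected ((\<lambda>t. f (x, t)) ` cball b s)"
      by (intro connected_continuous_image cslice) (use x sub in auto)
    ultimately have "0 \<in> (\<lambda>t. f (x, t)) ` cball b s"
      using ends(1,2) unfolding connected_iff_interval mult_less_0_iff
      by (meson image_eqI less_imp_le)
    then show ?thesis by auto
  qed
  then obtain g where g: "\<And>x. x \<in> cball a r \<Longrightarrow> g x \<in> cball b s \<and> f (x, g x) = 0"
    by metis
  have gr: "f (x, y) = 0 \<longleftrightarrow> y = g x" if "x \<in> cball a r" "y \<in> cball b s" for x y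
    using g[OF that(1)] uniq[of x y "g x"] that sub by auto
  have boxW: "cball a r \<times> cball b s \<subseteq> W" using box(1) sub by auto
  \<comment> \<open>This zero set is the graph of \<open>g\<close>, and a function into a compact
    set with closed graph is continuous.\<close>
  have "closed {p \<in> cball a r \<times> cball b s. f p = 0}"
    using continuous_closed_preimage_constant[OF continuous_on_subset[OF contf boxW]]
    by (simp add: closed_Times)
  moreover have "{p \<in> cball a r \<times> cball b s. f p = 0} = (\<lambda>x. (x, g x)) ` cball a r"
    using gr g by force
  ultimately have "continuous_on (cball a r) g"
    using g by (intro continuous_from_closed_graph[of "cball b s"]) auto
  with that[OF r(1) s(1) boxW this _ gr] g show thesis by auto
qed

text \<open>The error of the linear approximation of \<open>f\<close> is small against
  \<open>\<bar>x - a\<bar> + \<bar>h x - h a\<bar>\<close>. A first, coarse use of this bounds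
  \<open>h x - h a\<close> by a multiple of \<open>x - a\<close>; after that the error is small
  against \<open>x - a\<close> alone.\<close>

lemma implicit_has_derivative:
  fixes f :: "real \<times> real \<Rightarrow> real"
  assumes D: "(f has_derivative D) (at (a, h a))" and nz: "D (0, 1) \<noteq> 0"
    and fh: "\<And>x. f (x, h x) = 0" and cont: "isCont h a"
  shows "(h has_real_derivative - D (1, 0) / D (0, 1)) (at a)"
proof -
  define A B where "A = D (1, 0)" and "B = D (0, 1)"
  interpret bounded_linear D using D by (rule has_derivative_bounded_linear)
  have D_eq: "D (s, k) = A * s + B * k" for s k
    using add[of "s *\<^sub>R (1, 0)" "k *\<^sub>R (0, 1)"] scaleR[of s "(1, 0)"] scaleR[of k "(0, 1)"]
    by (simp add: A_def B_def)
  have B: "\<bar>B\<bar> > 0" using nz by (simp add: B_def)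
  \<comment> \<open>Since \<open>f\<close> vanishes along the graph of \<open>h\<close>, the linear
    part itself is the approximation error, up to sign.\<close>
  have lim: "\<forall>\<^sub>F x in at a. \<bar>A * (x - a) + B * (h x - h a)\<bar> \<le> e * (\<bar>x - a\<bar> + \<bar>h x - h a\<bar>)"
    if e: "e > 0" for e
  proof -
    obtain d where d: "d > 0"
      "\<And>q. norm (q - (a, h a)) < d \<Longrightarrow>
        norm (f q - f (a, h a) - D (q - (a, h a))) \<le> e * norm (q - (a, h a))"
      using conjunct2[OF iffD1[OF has_derivative_at_alt D]] e by metis
    have "isCont (\<lambda>x. (x, h x)) a" by (intro continuous_intros cont)
    then have "\<forall>\<^sub>F x in at a. dist (x, h x) (a, h a) < d"
      unfolding isCont_def using d(1) by (rule tendstoD)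
    then show ?thesis
    proof eventually_elim
      case (elim x)
      then have "\<bar>D (x - a, h x - h a)\<bar> \<le> e * norm (x - a, h x - h a)"
        using d(2)[of "(x, h x)"] fh by (simp add: dist_norm)
      also have "\<dots> \<le> e * (\<bar>x - a\<bar> + \<bar>h x - h a\<bar>)"
        using norm_Pair_le[of "x - a" "h x - h a"] e by simp
      finally show ?case by (simp add: D_eq)
    qed
  qed
  \<comment> \<open>The constant comes from \<open>lim\<close> with
    \<open>e = \<bar>B\<bar> / 2\<close>: half of
    \<open>\<bar>B\<bar> * \<bar>h x - h a\<bar>\<close> is then absorbed into the left-hand
    side.\<close>
  define C where "C = (2 * \<bar>A\<bar> + \<bar>B\<bar>) / \<bar>B\<bar>"
  have lip: "\<forall>\<^sub>F x in at a. \<bar>h x - h a\<bar> \<le> C * \<bar>x - a\<bar>"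
    using lim[OF half_gt_zero[OF B]]
  proof eventually_elim
    case (elim x)
    define s k where "s = x - a" and "k = h x - h a"
    have "\<bar>B\<bar> * \<bar>k\<bar> \<le> \<bar>A * s + B * k\<bar> + \<bar>A\<bar> * \<bar>s\<bar>"
      unfolding abs_mult[symmetric] by linarith
    also have "\<dots> \<le> \<bar>B\<bar> / 2 * (\<bar>s\<bar> + \<bar>k\<bar>) + \<bar>A\<bar> * \<bar>s\<bar>"
      using elim by (simp add: s_def k_def)
    finally have "\<bar>B\<bar> * \<bar>k\<bar> \<le> (2 * \<bar>A\<bar> + \<bar>B\<bar>) * \<bar>s\<bar>"
      by (simp add: field_simps)
    then show ?case using B by (simp add: C_def s_def k_def field_simps)
  qed
  have C: "C > 0" unfolding C_def using B by (intro divide_pos_pos) linarith+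
  show ?thesis
    unfolding has_field_derivative_def has_derivative_within_alt2
  proof (intro conjI allI impI)
    fix e :: real assume e: "e > 0"
    \<comment> \<open>Chosen so that the final bound \<open>e' * (1 + C)\<close> equals
      \<open>e * \<bar>B\<bar>\<close>, and cancelling \<open>\<bar>B\<bar>\<close> leaves
      \<open>e\<close>.\<close>
    define e' where "e' = e * \<bar>B\<bar> / (1 + C)"
    have "e' > 0" using e B C by (simp add: e'_def)
    from lim[OF this] lip
    show "\<forall>\<^sub>F x in at a. norm (h x - h a - - D (1, 0) / D (0, 1) * (x - a)) \<le> e * norm (x - a)"
    proof eventually_elim
      case (elim x)
      have "\<bar>B\<bar> * \<bar>h x - h a + A / B * (x - a)\<bar> = \<bar>A * (x - a) + B * (h x - h a)\<bar>"
        unfolding abs_mult[symmetric] using B by (intro arg_cong[of _ _ abs]) (simp add: field_simps)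
      also have "\<dots> \<le> e' * (\<bar>x - a\<bar> + C * \<bar>x - a\<bar>)"
        using elim \<open>e' > 0\<close> by (smt (verit) mult_left_mono)
      also have "\<dots> = (e' * (1 + C)) * \<bar>x - a\<bar>" by (simp add: algebra_simps)
      also have "e' * (1 + C) = \<bar>B\<bar> * e" using C by (simp add: e'_def)
      finally have "\<bar>h x - h a + A / B * (x - a)\<bar> \<le> e * \<bar>x - a\<bar>"
        using B by (simp add: mult.assoc)
      then show ?case by (simp add: A_def B_def)
    qed
  qed (simp add: bounded_linear_mult_right)
qed

section \<open>From symmetric implicit data to a global involution\<close>

lemma involution_onI:
  assumes "h 0 = 0" "\<And>x. h (h x) = x" "(h has_real_derivative -1) (at 0)"
    and "h C1_differentiable_on UNIV"
  shows "global_involution h"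
proof -
  have bij: "bij h" using assms(2) by (rule involuntory_imp_bij)
  then have "inv h = h" using assms(2) by (intro inv_unique_comp) auto
  then show ?thesis
    using assms bij by (simp add: involution_on_def C1_self_diffeo_def)
qed

lemma graph_if_symmetric_implicit_data:
  assumes "symmetric_implicit_data \<Omega> f"
  shows "\<exists>h. global_involution h \<and> zero_component \<Omega> f = graph_of h"
proof -
  define Z where "Z = {p \<in> \<Omega>. f p = 0}"
  define \<Gamma> where "\<Gamma> = zero_component \<Omega> f"
  have \<Omega>: "open \<Omega>" "(0, 0) \<in> \<Omega>" and "C1_on_plane f \<Omega>" and f0: "f (0, 0) = 0"
    and sym: "\<And>x y. (x, y) \<in> \<Omega> \<Longrightarrow> (y, x) \<in> \<Omega> \<and> f (y, x) = f (x, y)"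
    and partial2: "\<And>p. p \<in> \<Gamma> \<Longrightarrow> partial2 f p \<noteq> 0" and surj: "\<And>x. \<exists>y. (x, y) \<in> \<Gamma>"
    using assms unfolding symmetric_implicit_data_def \<Gamma>_def by blast+
  then obtain f' :: "real \<times> real \<Rightarrow> (real \<times> real) \<Rightarrow>\<^sub>L real"
    where f': "\<And>p. p \<in> \<Omega> \<Longrightarrow> (f has_derivative f' p) (at p)" and contf': "continuous_on \<Omega> f'"
    unfolding C1_on_plane_def by blast
  have \<Gamma>_eq: "\<Gamma> = connected_component_set Z (0, 0)"
    by (simp add: \<Gamma>_def zero_component_def Z_def)
  have \<Gamma>Z: "\<Gamma> \<subseteq> Z" unfolding \<Gamma>_eq by (rule connected_component_subset)
  have conn: "connected \<Gamma>" unfolding \<Gamma>_eq by simp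
  have zero: "(0, 0) \<in> \<Gamma>" using \<Omega> f0 by (simp add: \<Gamma>_eq Z_def)
  \<comment> \<open>Maximality of the component, used both for the local graphs and for the mirror
    image of \<Gamma>.\<close>
  have absorb: "N \<subseteq> \<Gamma>" if "connected N" "N \<subseteq> Z" "p \<in> N" "p \<in> \<Gamma>" for N p
    using that connected_component_maximal[of p N Z] connected_component_eq[of p Z "(0, 0)"]
    unfolding \<Gamma>_eq by simp
  have nz: "f' p (0, 1) \<noteq> 0" if "p \<in> \<Gamma>" for p
    using partial2[OF that] partial2_eq[OF f', of p] that \<Gamma>Z by (auto simp: Z_def)

  \<comment> \<open>The local graph is a connected set of zeros through a point of \<Gamma>, so it
    lies in \<Gamma>; inside the box \<Gamma> is therefore the full zero set. The free neighbourhood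
    \<open>U\<close> makes the boxes arbitrarily small, as local path connectedness
    requires.\<close>
  have local: "\<exists>r s g. r > 0 \<and> s > 0 \<and> cball a r \<times> cball b s \<subseteq> U \<and> continuous_on (cball a r) g \<and>
      (\<forall>x\<in>cball a r. \<forall>y\<in>cball b s. (x, y) \<in> \<Gamma> \<longleftrightarrow> y = g x) \<and>
      (\<lambda>x. (x, g x)) ` cball a r \<subseteq> \<Gamma> \<inter> cball a r \<times> cball b s"
    if ab: "(a, b) \<in> \<Gamma>" and U: "open U" "(a, b) \<in> U" for a b U
  proof -
    have inZ: "(a, b) \<in> \<Omega>" "f (a, b) = 0" using ab \<Gamma>Z by (auto simp: Z_def)
    obtain r s g where g: "r > 0" "s > 0" "cball a r \<times> cball b s \<subseteq> \<Omega> \<inter> U"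
      "continuous_on (cball a r) g" "g \<in> cball a r \<rightarrow> cball b s"
      "\<And>x y. x \<in> cball a r \<Longrightarrow> y \<in> cball b s \<Longrightarrow> f (x, y) = 0 \<longleftrightarrow> y = g x"
    proof (rule implicit_graph[of "\<Omega> \<inter> U" a b f f'])
      show "continuous_on (\<Omega> \<inter> U) f'" using contf' by (rule continuous_on_subset) auto
    qed (use \<Omega> U inZ f' nz[OF ab] in auto)
    define N where "N = (\<lambda>x. (x, g x)) ` cball a r"
    have "connected N"
      unfolding N_def by (intro connected_continuous_image continuous_intros g(4)) auto
    moreover have NZ: "N \<subseteq> Z" using g(3,5,6) by (auto simp: N_def Z_def Pi_iff)
    moreover have "(a, b) \<in> N"
      using g(6)[of a b] inZ g(1,2) by (auto simp: N_def)
    ultimately have N\<Gamma>: "N \<subseteq> \<Gamma>" using absorb ab by blast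
    have "(x, y) \<in> \<Gamma> \<longleftrightarrow> y = g x" if "x \<in> cball a r" "y \<in> cball b s" for x y
      using that g(6)[OF that] \<Gamma>Z N\<Gamma> by (auto simp: Z_def N_def)
    moreover have "N \<subseteq> cball a r \<times> cball b s" using g(5) by (auto simp: N_def)
    ultimately show ?thesis using g(1-4) N\<Gamma> unfolding N_def by blast
  qed

  have "locally path_connected \<Gamma>"
  proof (rule locallyI)
    fix w p assume "openin (top_of_set \<Gamma>) w" "p \<in> w"
    then obtain U where U: "open U" "w = \<Gamma> \<inter> U" by (auto simp: openin_open)
    obtain a b where p: "p = (a, b)" by (cases p)
    obtain r s g where g: "r > 0" "s > 0" "cball a r \<times> cball b s \<subseteq> U" "continuous_on (cball a r) g"
      "\<And>x y. x \<in> cball a r \<Longrightarrow> y \<in> cball b s \<Longrightarrow> (x, y) \<in> \<Gamma> \<longleftrightarrow> y = g x"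
      "(\<lambda>x. (x, g x)) ` cball a r \<subseteq> \<Gamma> \<inter> cball a r \<times> cball b s"
      using local[of a b U] U \<open>p \<in> w\<close> p by blast
    \<comment> \<open>The open box cuts out the neighbourhood \<open>u\<close>; the graph over the
      closed ball is the path connected set \<open>v\<close> containing it.\<close>
    show "\<exists>u v. openin (top_of_set \<Gamma>) u \<and> path_connected v \<and> p \<in> u \<and> u \<subseteq> v \<and> v \<subseteq> w"
    proof (intro exI conjI)
      show "openin (top_of_set \<Gamma>) (\<Gamma> \<inter> ball a r \<times> ball b s)"
        by (intro openin_open_Int open_Times open_ball)
      show "path_connected ((\<lambda>x. (x, g x)) ` cball a r)"
        by (intro path_connected_continuous_image continuous_intros g(4) convex_imp_path_connected) auto
      show "p \<in> \<Gamma> \<inter> ball a r \<times> ball b s" using p U \<open>p \<in> w\<close> g(1,2) by auto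
      show "\<Gamma> \<inter> ball a r \<times> ball b s \<subseteq> (\<lambda>x. (x, g x)) ` cball a r"
        using g(5) by force
      show "(\<lambda>x. (x, g x)) ` cball a r \<subseteq> w" using g(3,6) U by blast
    qed
  qed
  then have "path_connected \<Gamma>"
    using conn path_component_eq_connected_component_set
    by (metis connected_iff_eq_connected_component_set path_connected_component_set)
  then have inj: "inj_on fst \<Gamma>"
  proof (rule inj_on_fst_if_locally_inj)
    fix p assume "p \<in> \<Gamma>"
    obtain a b where p: "p = (a, b)" by (cases p)
    obtain r s g where g: "r > 0" "s > 0"
      "\<And>x y. x \<in> cball a r \<Longrightarrow> y \<in> cball b s \<Longrightarrow> (x, y) \<in> \<Gamma> \<longleftrightarrow> y = g x"
      using local[of a b UNIV] \<open>p \<in> \<Gamma>\<close> p by blast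
    show "\<exists>U. open U \<and> p \<in> U \<and> inj_on fst (\<Gamma> \<inter> U)"
      using g p by (intro exI[of _ "ball a r \<times> ball b s"]) (auto simp: inj_on_def open_Times)
  qed
  obtain h where h: "\<And>x. (x, h x) \<in> \<Gamma>" using surj by metis
  have \<Gamma>h: "(x, y) \<in> \<Gamma> \<longleftrightarrow> y = h x" for x y
    using inj_onD[OF inj, of "(x, y)" "(x, h x)"] h[of x] by auto

  have conth: "isCont h a" for a
  proof -
    obtain r s g where g: "r > 0" "s > 0" "cball a r \<times> cball (h a) s \<subseteq> UNIV"
      "continuous_on (cball a r) g"
      "\<And>x y. x \<in> cball a r \<Longrightarrow> y \<in> cball (h a) s \<Longrightarrow> (x, y) \<in> \<Gamma> \<longleftrightarrow> y = g x"
      "(\<lambda>x. (x, g x)) ` cball a r \<subseteq> \<Gamma> \<inter> cball a r \<times> cball (h a) s"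
      using local[OF h open_UNIV UNIV_I, of a] by blast
    \<comment> \<open>The continuous local branch lies in \<Gamma>, so it must agree with
      \<open>h\<close>, which is so far only a pointwise choice.\<close>
    have "g x = h x" if "x \<in> cball a r" for x
      using g(6) that \<Gamma>h[of x "g x"] by blast
    with g(4) have "continuous_on (cball a r) h" by (rule continuous_on_eq)
    then show ?thesis by (rule continuous_on_interior) (use g(1) in simp)
  qed
  have h\<Omega>: "(x, h x) \<in> \<Omega>" and fh: "f (x, h x) = 0" for x
    using h[of x] \<Gamma>Z by (auto simp: Z_def)
  define D where "D = (\<lambda>x. - f' (x, h x) (1, 0) / f' (x, h x) (0, 1))"
  have derh: "(h has_real_derivative D x) (at x)" for x
    unfolding D_def by (rule implicit_has_derivative[OF f'[OF h\<Omega>] nz[OF h] fh conth])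
  have "continuous_on UNIV (\<lambda>x. f' (x, h x))"
    using conth h\<Omega> by (intro continuous_on_compose2[OF contf'] continuous_intros)
      (auto intro: continuous_at_imp_continuous_on)
  then have "continuous_on UNIV D"
    unfolding D_def using nz h by (intro continuous_intros) auto
  then have C1: "h C1_differentiable_on UNIV"
    unfolding C1_differentiable_on_def using derh
    by (auto simp: has_real_derivative_iff_has_vector_derivative)

  have "prod.swap ` \<Gamma> \<subseteq> \<Gamma>"
  proof (rule absorb[OF _ _ _ zero])
    show "connected (prod.swap ` \<Gamma>)"
      by (intro connected_continuous_image conn continuous_on_swap)
    show "prod.swap ` \<Gamma> \<subseteq> Z" using \<Gamma>Z sym by (fastforce simp: Z_def)
    show "(0, 0) \<in> prod.swap ` \<Gamma>" using zero by force
  qed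
  then have "(h x, x) \<in> \<Gamma>" for x using h[of x] by force
  then have invol: "h (h x) = x" for x using \<Gamma>h by metis
  have h0: "h 0 = 0" using zero \<Gamma>h by metis

  \<comment> \<open>The reflection fixes the origin and \<open>f\<close> is invariant under it on
    \<Omega>, so uniqueness of the derivative equates the two partial derivatives there.\<close>
  have "((\<lambda>p. f (prod.swap p)) has_derivative (\<lambda>v. f' (0, 0) (prod.swap v))) (at (0, 0))"
    by (rule has_derivative_compose[where g = f])
      (use f'[OF \<Omega>(2)] in \<open>auto simp: prod.swap_def intro!: derivative_eq_intros\<close>)
  then have "(f has_derivative (\<lambda>v. f' (0, 0) (prod.swap v))) (at (0, 0))"
    by (rule has_derivative_transform_within_open[OF _ \<Omega>]) (use sym in auto)
  then have "(\<lambda>v. f' (0, 0) (prod.swap v)) = f' (0, 0)"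
    using f'[OF \<Omega>(2)] by (rule has_derivative_unique)
  then have "f' (0, 0) (1, 0) = f' (0, 0) (0, 1)"
    by (metis swap_simp)
  then have "D 0 = -1" using nz[OF zero] by (simp add: D_def h0)
  then have "global_involution h"
    using involution_onI[OF h0 invol _ C1] derh[of 0] by simp
  moreover have "\<Gamma> = graph_of h" using \<Gamma>h by (auto simp: graph_of_def)
  ultimately show ?thesis unfolding \<Gamma>_def by blast
qed

section \<open>From a global involution to symmetric implicit data\<close>

lemma global_involutionD:
  assumes "global_involution h"
  shows "h 0 = 0" "h (h x) = x" "(h has_real_derivative -1) (at 0)" "h C1_differentiable_on UNIV"
proof -
  have "inj h" "inv h (h x) = h (h x)"
    using assms unfolding involution_on_def C1_self_diffeo_def bij_betw_def by blast+
  then show "h (h x) = x" by (metis inv_f_f)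
qed (use assms in \<open>auto simp: involution_on_def C1_self_diffeo_def\<close>)

text \<open>Differentiating \<open>h (h x) = x\<close> shows that \<open>D\<close> has no zero;
  being continuous with value -1 at the origin, it keeps that sign.\<close>

lemma global_involution_deriv_neg:
  assumes h: "global_involution h"
    and D: "\<And>x. (h has_real_derivative D x) (at x)" and contD: "continuous_on UNIV D"
  shows "D x < 0"
proof -
  note h = global_involutionD[OF h]
  have "D (h y) * D y = 1" for y
  proof -
    have "((\<lambda>x. h (h x)) has_real_derivative D (h y) * D y) (at y)"
      by (rule DERIV_chain2[OF D D])
    then show ?thesis using h(2) DERIV_unique[OF _ DERIV_ident] by simp
  qed
  then have nz: "D y \<noteq> 0" for y by (metis mult_zero_right zero_neq_one)
  have "connected (range D)" by (intro connected_continuous_image contD) auto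
  moreover have "D 0 = -1" using DERIV_unique[OF D h(3)] .
  moreover have "0 \<notin> range D" using nz by (metis imageE)
  ultimately show ?thesis
    using rangeI[of D 0] rangeI[of D x] unfolding connected_iff_interval
    by (metis linorder_le_less_linear neg_le_0_iff_le zero_le_one)
qed

lemma symmetric_implicit_data_if_global_involution:
  assumes "global_involution h"
  shows "\<exists>\<Omega> f. symmetric_implicit_data \<Omega> f \<and> zero_component \<Omega> f = graph_of h"
proof -
  note h = global_involutionD[OF assms]
  obtain D where D: "\<And>x. (h has_real_derivative D x) (at x)" and contD: "continuous_on UNIV D"
    using h(4) unfolding C1_differentiable_on_def
    by (auto simp: has_real_derivative_iff_has_vector_derivative)
  have neg: "D x < 0" for x
    using global_involution_deriv_neg[OF assms D contD] .
  define f where "f = (\<lambda>p. (fst p - h (fst p)) + (snd p - h (snd p)))"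
  \<comment> \<open>With fixed bounded linear maps and scalar coefficients, continuity in operator
    norm reduces to continuity of \<open>D\<close>.\<close>
  define f' where "f' = (\<lambda>p. (1 - D (fst p)) *\<^sub>R fst_blinfun + (1 - D (snd p)) *\<^sub>R snd_blinfun
    :: (real \<times> real) \<Rightarrow>\<^sub>L real)"
  have derf: "(f has_derivative f' p) (at p)" for p
  proof -
    have "((\<lambda>q. h (fst q)) has_derivative (\<lambda>v. D (fst p) * fst v)) (at p)"
      "((\<lambda>q. h (snd q)) has_derivative (\<lambda>v. D (snd p) * snd v)) (at p)"
      using has_derivative_compose[OF _ D[unfolded has_field_derivative_def]]
        has_derivative_fst[OF has_derivative_ident] has_derivative_snd[OF has_derivative_ident]
      by blast+
    then show ?thesis
      unfolding f_def f'_def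
      by (auto intro!: derivative_eq_intros simp: blinfun.bilinear_simps algebra_simps)
  qed
  have "continuous_on UNIV f'"
    unfolding f'_def by (intro continuous_intros continuous_on_compose2[OF contD]) auto
  then have C1: "C1_on_plane f UNIV" using derf by (auto simp: C1_on_plane_def)
  have "strict_mono (\<lambda>y. y - h y)"
  proof (rule strict_monoI)
    fix y z :: real assume "y < z"
    then show "y - h y < z - h z"
    proof (rule DERIV_pos_imp_increasing)
      fix x
      show "\<exists>l. ((\<lambda>y. y - h y) has_real_derivative l) (at x) \<and> 0 < l"
        using neg[of x] by (intro exI[of _ "1 - D x"]) (auto intro!: derivative_eq_intros D)
    qed
  qed
  then have inj: "y - h y = z - h z \<longleftrightarrow> y = z" for y z
    by (rule strict_mono_eq)
  \<comment> \<open>As \<open>h (h x) = x\<close>, the term \<open>x - h x\<close> is the negative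
    of \<open>h x - h (h x)\<close>, so the equation says that \<open>t - h t\<close> takes equal
    values at \<open>y\<close> and \<open>h x\<close>.\<close>
  have "f (x, y) = 0 \<longleftrightarrow> y = h x" for x y
    using inj[of y "h x"] h(2)[of x] by (simp add: f_def algebra_simps)
  then have Z: "{p \<in> UNIV. f p = 0} = graph_of h"
    by (auto simp: graph_of_def)
  \<comment> \<open>As a continuous image of the line, the whole zero set is connected, so it is its
    own component.\<close>
  have "graph_of h = (\<lambda>x. (x, h x)) ` UNIV"
    by (auto simp: graph_of_def)
  moreover have "continuous_on UNIV h"
    using D DERIV_isCont by (blast intro: continuous_at_imp_continuous_on)
  ultimately have "connected (graph_of h)"
    by (auto intro!: connected_continuous_image continuous_intros)
  then have comp: "zero_component UNIV f = graph_of h"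
    unfolding zero_component_def Z
    by (rule connected_component_eq_self) (simp add: graph_of_def h(1))
  have "partial2 f p = 1 - D (snd p)" for p
    using partial2_eq[OF derf] by (simp add: f'_def blinfun.bilinear_simps)
  then have "partial2 f p \<noteq> 0" for p
    using neg[of "snd p"] by simp
  then have "symmetric_implicit_data UNIV f"
    unfolding symmetric_implicit_data_def comp
    using C1 h(1) by (auto simp: f_def graph_of_def)
  with comp show ?thesis by blast
qed

theorem theorem3p1:
  shows "(\<forall>\<Omega> f. symmetric_implicit_data \<Omega> f \<longrightarrow>
            (\<exists>h. global_involution h \<and> zero_component \<Omega> f = graph_of h)) \<and>
         (\<forall>h. global_involution h \<longrightarrow>
            (\<exists>\<Omega> f. symmetric_implicit_data \<Omega> f \<and> zero_component \<Omega> f = graph_of h))"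
  using graph_if_symmetric_implicit_data symmetric_implicit_data_if_global_involution by blast

end
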